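(* Let $F=\hat f+\tau\hat g$ on $\mathcal{R}^n$ with $\tau>0$, where $\hat f:\mathcal{R}^n\to\mathcal{R}$ is $L_{\hat f}$-smooth and $\mu_{\hat f}$-strongly convex and $\hat g:\mathcal{R}^n\to\mathcal{R}$ is a simple convex lower semi-continuous function. Then for every $L\ge L_{\hat f}$ (with $L>0$) and all $x,y\in\mathcal{R}^n$, $$F(x)\ \ge\ \hat f(T_L(y))+\tau\hat g(T_L(y))+r_L(y)^T(x-y)+\frac{\mu_{\hat f}}{2}\|x-y\|^2+\frac{1}{2L}\|r_L(y)\|^2 .$$
   Context: $\|\cdot\|$ is the Euclidean norm on $\mathcal{R}^n$. "$L_{\hat f}$-smooth" means $\hat f$ is differentiable with $L_{\hat f}$-Lipschitz gradient; "$\mu_{\hat f}$-strongly convex" allows $\mu_{\hat f}=0$, with $0\le\mu_{\hat f}\le L_{\hat f}$. "Simple" only means that the proximal map of $\hat g$ is cheap to compute. For $L\ge L_{\hat f}$ and $x,y\in\mathcal{R}^n$ define $$m_L(y;x)=\hat f(y)+\nabla\hat f(y)^T(x-y)+\frac L2\|x-y\|^2+\tau\hat g(x).$$ The composite gradient mapping is $T_L(y)=\arg\min_{x\in\mathcal{R}^n}m_L(y;x)$ and the composite reduced gradient is $r_L(y)=L\,(y-T_L(y))$. *)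

theory Defs
  imports "HOL-Analysis.Analysis"
begin

(* Only meaningful where f is differentiable; the gradient is then unique. *)
definition gradient :: "('a::real_inner \<Rightarrow> real) \<Rightarrow> 'a \<Rightarrow> 'a" where
  "gradient f x = (THE D. GDERIV f x :> D)"

definition smooth_with :: "real \<Rightarrow> ('a::real_inner \<Rightarrow> real) \<Rightarrow> bool" where
  "smooth_with L f \<longleftrightarrow> (\<forall>x. f differentiable (at x)) \<and> L-lipschitz_on UNIV (gradient f)"

(* No sign condition on mu; for mu = 0 this is ordinary convexity. *)
definition strongly_convex :: "real \<Rightarrow> ('a::real_inner \<Rightarrow> real) \<Rightarrow> bool" where
  "strongly_convex \<mu> f \<longleftrightarrow>
    (\<forall>x y. \<forall>u\<ge>0. \<forall>v\<ge>0. u + v = 1 \<longrightarrow>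
      f (u *\<^sub>R x + v *\<^sub>R y) \<le> u * f x + v * f y - \<mu> / 2 * u * v * (norm (x - y))\<^sup>2)"

definition lower_semicontinuous :: "('a::topological_space \<Rightarrow> real) \<Rightarrow> bool" where
  "lower_semicontinuous g \<longleftrightarrow> (\<forall>x. \<forall>c<g x. eventually (\<lambda>y. c < g y) (nhds x))"

definition composite_model ::
    "('a::real_inner \<Rightarrow> real) \<Rightarrow> ('a \<Rightarrow> real) \<Rightarrow> real \<Rightarrow> real \<Rightarrow> 'a \<Rightarrow> 'a \<Rightarrow> real" where
  "composite_model f g \<tau> L y x =
    f y + gradient f y \<bullet> (x - y) + L / 2 * (norm (x - y))\<^sup>2 + \<tau> * g x"

(* arg_min picks some minimizer if one exists and is unspecified otherwise;
   on a Euclidean space the minimizer exists and is unique for L > 0, \<tau> > 0 and g convex. *)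
definition composite_gradient_map ::
    "('a::real_inner \<Rightarrow> real) \<Rightarrow> ('a \<Rightarrow> real) \<Rightarrow> real \<Rightarrow> real \<Rightarrow> 'a \<Rightarrow> 'a" where
  "composite_gradient_map f g \<tau> L y = arg_min (composite_model f g \<tau> L y) (\<lambda>_. True)"

definition reduced_gradient ::
    "('a::real_inner \<Rightarrow> real) \<Rightarrow> ('a \<Rightarrow> real) \<Rightarrow> real \<Rightarrow> real \<Rightarrow> 'a \<Rightarrow> 'a" where
  "reduced_gradient f g \<tau> L y = L *\<^sub>R (y - composite_gradient_map f g \<tau> L y)"

end

theory Submission
  imports Defs
begin

text \<open>
  Write \<open>m\<close> for the model \<open>composite_model f g \<tau> L y\<close> and \<open>p\<close> for its minimizer
  \<open>composite_gradient_map f g \<tau> L y\<close>.  The model is squeezed against \<open>F\<close> at the two points involved.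
  At \<open>p\<close>, smoothness of \<open>f\<close> with constant at most \<open>L\<close> gives \<open>F p \<le> m p\<close>
  (\<open>smooth_with_quadratic_upper_bound\<close>).  At \<open>x\<close>, strong convexity of \<open>f\<close> says that \<open>F\<close> lies above
  the model with its curvature \<open>L\<close> replaced by \<open>\<mu>\<close> (\<open>strongly_convex_quadratic_lower_bound\<close>).
  The two points are linked by the model itself: it is \<open>L\<close>-strongly convex, hence grows at least
  like \<open>L / 2 * (norm (x - p))\<^sup>2\<close> away from its minimizer
  (\<open>strongly_convex_growth_at_minimizer\<close>).  Chaining these leaves the difference
  \<open>L / 2 * ((norm (x - p))\<^sup>2 - (norm (x - y))\<^sup>2)\<close>, which is exactly the reduced-gradient contribution
  once the first square is expanded around \<open>y\<close>.

  The growth argument requires a genuine minimizer.  A convex function on a Euclidean space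
  is continuous and falls at most linearly at infinity, so the quadratic term makes the model
  coercive (\<open>composite_gradient_map_minimizes\<close>).  Quadratic growth at \<open>p\<close>
  plays the part of the optimality condition \<open>r L y - gradient f y \<in> \<tau> \<partial>g p\<close>, where \<open>r L y\<close> is
  the reduced gradient \<open>L *\<^sub>R (y - p)\<close>.
\<close>

section \<open>First-order bounds for smooth and strongly convex functions\<close>

lemma GDERIV_gradient:
  fixes f :: "'a::euclidean_space \<Rightarrow> real"
  assumes "f differentiable (at x)"
  shows "GDERIV f x :> gradient f x"
proof -
  obtain f' where f': "(f has_derivative f') (at x)"
    using assms differentiable_def by blast
  \<comment> \<open>Riesz representative of the derivative\<close>
  define D where "D = (\<Sum>b\<in>Basis. f' b *\<^sub>R b)"
  have "f' h = h \<bullet> D" for h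
  proof -
    interpret bounded_linear f' using f' by (rule has_derivative_bounded_linear)
    have "f' h = f' (\<Sum>b\<in>Basis. (h \<bullet> b) *\<^sub>R b)" by (simp add: euclidean_representation)
    also have "\<dots> = h \<bullet> D"
      by (simp add: D_def sum scaleR inner_sum_right mult.commute)
    finally show ?thesis .
  qed
  then have D: "GDERIV f x :> D"
    using f' unfolding gderiv_def by presburger
  moreover have "E = D" if "GDERIV f x :> E" for E
  proof -
    have "(\<lambda>h. h \<bullet> E) = (\<lambda>h. h \<bullet> D)"
      using that D unfolding gderiv_def by (rule has_derivative_unique)
    then have "\<forall>h. h \<bullet> E = h \<bullet> D" by (simp add: fun_eq_iff)
    then show ?thesis by (simp only: vector_eq_ldot)
  qed
  ultimately show ?thesis
    unfolding gradient_def by (rule theI)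
qed

lemma GDERIV_along_line:
  assumes "GDERIV f (y + t *\<^sub>R d) :> D"
  shows "((\<lambda>t. f (y + t *\<^sub>R d)) has_real_derivative D \<bullet> d) (at t)"
proof -
  have "((\<lambda>t. y + t *\<^sub>R d) has_derivative (\<lambda>s. s *\<^sub>R d)) (at t)"
    by (auto intro!: derivative_eq_intros)
  from has_derivative_compose[OF this assms[unfolded gderiv_def]]
  have "((\<lambda>t. f (y + t *\<^sub>R d)) has_derivative (\<lambda>s. s *\<^sub>R d \<bullet> D)) (at t)" .
  moreover have "(\<lambda>s. s *\<^sub>R d \<bullet> D) = (*) (D \<bullet> d)"
    by (simp add: fun_eq_iff inner_commute)
  ultimately show ?thesis
    by (simp only: has_field_derivative_def)
qed

text \<open>
  Along the segment from \<open>y\<close> to \<open>x\<close>, subtracting the claimed quadratic bound from \<open>f\<close> leaves a function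
  with nonpositive derivative, by the Lipschitz condition on the gradient.
\<close>

lemma smooth_with_quadratic_upper_bound:
  fixes f :: "'a::euclidean_space \<Rightarrow> real"
  assumes "smooth_with L f"
  shows "f x \<le> f y + gradient f y \<bullet> (x - y) + L / 2 * (norm (x - y))\<^sup>2"
proof -
  define d where "d = x - y"
  define \<phi> where "\<phi> t = f (y + t *\<^sub>R d) - t * (gradient f y \<bullet> d) - L / 2 * t\<^sup>2 * (norm d)\<^sup>2" for t
  define \<phi>' where
    "\<phi>' t = gradient f (y + t *\<^sub>R d) \<bullet> d - gradient f y \<bullet> d - L * t * (norm d)\<^sup>2" for t
  have deriv: "(\<phi> has_real_derivative \<phi>' t) (at t)" for t
  proof -
    have "((\<lambda>t. f (y + t *\<^sub>R d)) has_real_derivative gradient f (y + t *\<^sub>R d) \<bullet> d) (at t)"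
      using assms by (intro GDERIV_along_line GDERIV_gradient) (simp add: smooth_with_def)
    then show ?thesis
      unfolding \<phi>_def \<phi>'_def by (auto intro!: derivative_eq_intros)
  qed
  have "\<phi>' t \<le> 0" if "0 \<le> t" for t
  proof -
    have "gradient f (y + t *\<^sub>R d) \<bullet> d - gradient f y \<bullet> d
        \<le> norm (gradient f (y + t *\<^sub>R d) - gradient f y) * norm d"
      by (metis inner_diff_left norm_cauchy_schwarz)
    also have "\<dots> \<le> (L * norm (t *\<^sub>R d)) * norm d"
      using assms lipschitz_on_normD[of L UNIV "gradient f" "y + t *\<^sub>R d" y]
      by (intro mult_right_mono) (auto simp: smooth_with_def)
    finally show ?thesis
      using that by (simp add: \<phi>'_def power2_eq_square algebra_simps)
  qed
  then have "\<exists>D. DERIV \<phi> t :> D \<and> D \<le> 0" if "0 \<le> t" for t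
    using deriv that by blast
  then have "\<phi> 1 \<le> \<phi> 0"
    by (rule DERIV_nonpos_imp_nonincreasing[OF zero_le_one])
  then show ?thesis
    by (simp add: \<phi>_def d_def)
qed

text \<open>
  The definition compares function values along the segment from \<open>y\<close> to \<open>x\<close>; both
  quadratic lower bounds below follow by letting the step \<open>t\<close> tend to zero in this form.
\<close>

lemma strongly_convex_secant:
  assumes "strongly_convex \<mu> f" "0 < t" "t \<le> 1"
  shows "(f (y + t *\<^sub>R (x - y)) - f y) / t + \<mu> / 2 * (1 - t) * (norm (x - y))\<^sup>2 \<le> f x - f y"
proof -
  have "f (t *\<^sub>R x + (1 - t) *\<^sub>R y)
      \<le> t * f x + (1 - t) * f y - \<mu> / 2 * t * (1 - t) * (norm (x - y))\<^sup>2"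
    using assms(1)[unfolded strongly_convex_def, rule_format, of t "1 - t" x y] assms(2,3) by simp
  moreover have "t *\<^sub>R x + (1 - t) *\<^sub>R y = y + t *\<^sub>R (x - y)"
    by (simp add: algebra_simps)
  ultimately have "f (y + t *\<^sub>R (x - y)) - f y
      \<le> t * (f x - f y - \<mu> / 2 * (1 - t) * (norm (x - y))\<^sup>2)"
    by (simp add: algebra_simps)
  then have "(f (y + t *\<^sub>R (x - y)) - f y) / t \<le> f x - f y - \<mu> / 2 * (1 - t) * (norm (x - y))\<^sup>2"
    using \<open>0 < t\<close> by (simp add: pos_divide_le_eq mult.commute)
  then show ?thesis by simp
qed

lemma strongly_convex_quadratic_lower_bound:
  assumes "strongly_convex \<mu> f" "GDERIV f y :> D"
  shows "f y + D \<bullet> (x - y) + \<mu> / 2 * (norm (x - y))\<^sup>2 \<le> f x"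
proof -
  have "((\<lambda>t. f (y + t *\<^sub>R (x - y))) has_real_derivative D \<bullet> (x - y)) (at 0)"
    using assms(2) by (intro GDERIV_along_line) simp
  then have "((\<lambda>t. (f (y + t *\<^sub>R (x - y)) - f y) / t) \<longlongrightarrow> D \<bullet> (x - y)) (at_right 0)"
    by (auto simp: DERIV_def intro: tendsto_within_subset)
  then have "((\<lambda>t. (f (y + t *\<^sub>R (x - y)) - f y) / t + \<mu> / 2 * (1 - t) * (norm (x - y))\<^sup>2)
      \<longlongrightarrow> D \<bullet> (x - y) + \<mu> / 2 * (1 - 0) * (norm (x - y))\<^sup>2) (at_right 0)"
    by (intro tendsto_intros)
  moreover have "eventually (\<lambda>t. (f (y + t *\<^sub>R (x - y)) - f y) / t
      + \<mu> / 2 * (1 - t) * (norm (x - y))\<^sup>2 \<le> f x - f y) (at_right 0)"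
    using eventually_at_right_less eventually_at_right_real[OF zero_less_one]
    by eventually_elim (rule strongly_convex_secant[OF assms(1)], auto)
  ultimately have "D \<bullet> (x - y) + \<mu> / 2 * (1 - 0) * (norm (x - y))\<^sup>2 \<le> f x - f y"
    by (rule tendsto_upperbound) simp
  then show ?thesis by simp
qed

text \<open>
  This is the previous bound with \<open>D = 0\<close>, for functions that may have no derivative at \<open>p\<close>:
  minimality alone makes every difference quotient there nonnegative.
\<close>

lemma strongly_convex_growth_at_minimizer:
  assumes "strongly_convex \<mu> f" and min: "\<And>z. f p \<le> f z"
  shows "f p + \<mu> / 2 * (norm (x - p))\<^sup>2 \<le> f x"
proof -
  have "((\<lambda>t. \<mu> / 2 * (1 - t) * (norm (x - p))\<^sup>2)
      \<longlongrightarrow> \<mu> / 2 * (1 - 0) * (norm (x - p))\<^sup>2) (at_right 0)"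
    by (intro tendsto_intros)
  moreover have "eventually (\<lambda>t. \<mu> / 2 * (1 - t) * (norm (x - p))\<^sup>2 \<le> f x - f p) (at_right 0)"
    using eventually_at_right_real[OF zero_less_one]
  proof eventually_elim
    case (elim t)
    then have "0 \<le> (f (p + t *\<^sub>R (x - p)) - f p) / t"
      using min by simp
    then show ?case
      using strongly_convex_secant[OF assms(1), of t p x] elim by simp
  qed
  ultimately have "\<mu> / 2 * (1 - 0) * (norm (x - p))\<^sup>2 \<le> f x - f p"
    by (rule tendsto_upperbound) simp
  then show ?thesis by simp
qed

section \<open>The composite model and its minimizer\<close>

text \<open>
  The squared distance to \<open>y\<close> satisfies the inequality defining strong convexity with equality, so
  the modulus is \<open>L\<close> whatever \<open>f\<close> is: the model sees only the linearization of \<open>f\<close> at \<open>y\<close>.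
\<close>

lemma strongly_convex_composite_model:
  assumes "convex_on UNIV g" "0 \<le> \<tau>"
  shows "strongly_convex L (composite_model f g \<tau> L y)"
  unfolding strongly_convex_def
proof (intro allI impI)
  fix a b and u v :: real
  assume uv: "0 \<le> u" "0 \<le> v" "u + v = 1"
  define \<alpha> \<beta> where "\<alpha> = a - y" and "\<beta> = b - y"
  have v: "v = 1 - u" using uv by simp
  have "g (u *\<^sub>R a + v *\<^sub>R b) \<le> u * g a + v * g b"
    using assms(1) uv unfolding convex_on_def by auto
  then have g: "\<tau> * g (u *\<^sub>R a + v *\<^sub>R b) \<le> \<tau> * (u * g a + v * g b)"
    using assms(2) by (rule mult_left_mono)
  have shift: "u *\<^sub>R a + v *\<^sub>R b - y = u *\<^sub>R \<alpha> + v *\<^sub>R \<beta>"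
    by (simp add: \<alpha>_def \<beta>_def v algebra_simps)
  have diff: "\<alpha> - \<beta> = a - b"
    by (simp add: \<alpha>_def \<beta>_def)
  have norm_comb: "(norm (u *\<^sub>R \<alpha> + v *\<^sub>R \<beta>))\<^sup>2
      = u * (norm \<alpha>)\<^sup>2 + v * (norm \<beta>)\<^sup>2 - u * v * (norm (\<alpha> - \<beta>))\<^sup>2"
    unfolding v power2_norm_eq_inner
    by (simp add: inner_add inner_diff inner_commute algebra_simps)
  have sq: "L / 2 * (norm (u *\<^sub>R a + v *\<^sub>R b - y))\<^sup>2
      = u * (L / 2 * (norm \<alpha>)\<^sup>2) + v * (L / 2 * (norm \<beta>)\<^sup>2) - L / 2 * u * v * (norm (a - b))\<^sup>2"
    unfolding shift norm_comb diff by (simp add: algebra_simps)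
  have lin: "gradient f y \<bullet> (u *\<^sub>R a + v *\<^sub>R b - y)
      = u * (gradient f y \<bullet> \<alpha>) + v * (gradient f y \<bullet> \<beta>)"
    unfolding shift by (simp add: inner_add)
  have const: "f y = u * f y + v * f y" by (simp add: v algebra_simps)
  show "composite_model f g \<tau> L y (u *\<^sub>R a + v *\<^sub>R b)
    \<le> u * composite_model f g \<tau> L y a + v * composite_model f g \<tau> L y b
      - L / 2 * u * v * (norm (a - b))\<^sup>2"
    using g sq lin const unfolding composite_model_def \<alpha>_def \<beta>_def
    by (simp add: distrib_left mult.left_commute diff_divide_distrib add_divide_distrib)
qed

text \<open>
  \<open>C\<close> is the largest drop of \<open>g\<close> on the unit ball around \<open>y\<close>: along a ray from \<open>y\<close>, convexity
  forbids any faster average descent further out.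
\<close>

lemma convex_on_linear_lower_bound:
  fixes g :: "'a::euclidean_space \<Rightarrow> real"
  assumes "convex_on UNIV g"
  obtains C where "0 \<le> C" "\<And>x. 1 \<le> norm (x - y) \<Longrightarrow> g y - C * norm (x - y) \<le> g x"
proof -
  have "continuous_on (cball y 1) g"
    using convex_on_continuous[OF open_UNIV assms] continuous_on_subset by blast
  then obtain q where q: "\<forall>z\<in>cball y 1. g q \<le> g z"
    using continuous_attains_inf[of "cball y 1" g] by auto
  have "g y - (g y - g q) * norm (x - y) \<le> g x" if far: "1 \<le> norm (x - y)" for x
  proof -
    define \<rho> where "\<rho> = norm (x - y)"
    have \<rho>: "1 \<le> \<rho>" using far by (simp add: \<rho>_def)
    define z where "z = (1 - 1 / \<rho>) *\<^sub>R y + (1 / \<rho>) *\<^sub>R x"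
    have "z - y = (1 / \<rho>) *\<^sub>R (x - y)"
      by (simp add: z_def algebra_simps)
    then have "norm (z - y) = 1"
      using \<rho> by (auto simp: \<rho>_def)
    then have "g q \<le> g z"
      by (intro q[rule_format]) (simp add: dist_norm norm_minus_commute)
    also have "g z \<le> (1 - 1 / \<rho>) * g y + 1 / \<rho> * g x"
      unfolding z_def using \<rho> by (intro convex_onD[OF assms]) auto
    finally have "\<rho> * g q \<le> \<rho> * ((1 - 1 / \<rho>) * g y + 1 / \<rho> * g x)"
      using \<rho> by simp
    also have "\<dots> = (\<rho> - 1) * g y + g x"
      using \<rho> by (simp add: field_simps)
    finally show ?thesis
      by (simp add: \<rho>_def algebra_simps)
  qed
  moreover have "0 \<le> g y - g q"
    using q by simp
  ultimately show ?thesis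
    using that by blast
qed

text \<open>
  The quadratic term of the model outgrows the at most linear descent of its other terms, so only
  a compact ball around \<open>y\<close> competes for the minimum.
\<close>

lemma composite_gradient_map_minimizes:
  fixes f g :: "'a::euclidean_space \<Rightarrow> real"
  assumes "convex_on UNIV g" "0 \<le> \<tau>" "0 < L"
  shows "composite_model f g \<tau> L y (composite_gradient_map f g \<tau> L y) \<le> composite_model f g \<tau> L y z"
proof -
  let ?m = "composite_model f g \<tau> L y"
  obtain C where "0 \<le> C"
    and g_lower: "\<And>x. 1 \<le> norm (x - y) \<Longrightarrow> g y - C * norm (x - y) \<le> g x"
    using convex_on_linear_lower_bound[OF assms(1)] by metis
  define K where "K = norm (gradient f y) + \<tau> * C"
  have "0 \<le> K"
    using \<open>0 \<le> C\<close> assms by (simp add: K_def)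
  define R where "R = 1 + 2 * K / L"
  have "1 \<le> R"
    using \<open>0 \<le> K\<close> assms by (simp add: R_def)
  have far: "?m y \<le> ?m x" if "R \<le> norm (x - y)" for x
  proof -
    define \<rho> where "\<rho> = norm (x - y)"
    have "1 \<le> \<rho>" "R \<le> \<rho>"
      using that \<open>1 \<le> R\<close> by (auto simp: \<rho>_def)
    have "2 * K / L \<le> \<rho>"
      using \<open>R \<le> \<rho>\<close> by (simp add: R_def)
    then have "K \<le> L / 2 * \<rho>"
      using assms by (simp add: field_simps)
    then have "K * \<rho> \<le> L / 2 * \<rho>\<^sup>2"
      using mult_right_mono[of K "L / 2 * \<rho>" \<rho>] \<open>1 \<le> \<rho>\<close> by (simp add: power2_eq_square)
    moreover have "- (norm (gradient f y) * \<rho>) \<le> gradient f y \<bullet> (x - y)"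
      using Cauchy_Schwarz_ineq2[of "gradient f y" "x - y"] by (simp add: \<rho>_def)
    moreover have "\<tau> * (g y - C * \<rho>) \<le> \<tau> * g x"
      using g_lower[of x] \<open>1 \<le> \<rho>\<close> assms by (intro mult_left_mono) (auto simp: \<rho>_def)
    ultimately show ?thesis
      by (simp add: composite_model_def K_def \<rho>_def algebra_simps)
  qed
  have "continuous_on (cball y R) g"
    using convex_on_continuous[OF open_UNIV assms(1)] continuous_on_subset by blast
  then have "continuous_on (cball y R) ?m"
    unfolding composite_model_def by (intro continuous_intros)
  then obtain p where p: "\<forall>x\<in>cball y R. ?m p \<le> ?m x"
    using continuous_attains_inf[of "cball y R" ?m] \<open>1 \<le> R\<close> by auto
  have p_min: "?m p \<le> ?m x" for x
  proof (cases "x \<in> cball y R")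
    case False
    then have "?m y \<le> ?m x"
      by (intro far) (simp add: dist_norm norm_minus_commute)
    moreover have "?m p \<le> ?m y"
      using \<open>1 \<le> R\<close> by (intro p[rule_format]) simp
    ultimately show ?thesis by linarith
  qed (use p in blast)
  then have "is_arg_min ?m (\<lambda>_. True) p"
    by (simp add: is_arg_min_def not_less)
  then have "is_arg_min ?m (\<lambda>_. True) (composite_gradient_map f g \<tau> L y)"
    unfolding composite_gradient_map_def arg_min_def by (rule someI)
  then show ?thesis
    by (simp add: is_arg_min_def not_less)
qed

theorem theorem1:
  fixes f g :: "real ^ 'n \<Rightarrow> real"
    and \<tau> \<mu> L\<^sub>f L :: real
    and x y :: "real ^ 'n"
  assumes "\<tau> > 0"
    and "0 \<le> \<mu>" and "\<mu> \<le> L\<^sub>f"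
    and "smooth_with L\<^sub>f f"
    and "strongly_convex \<mu> f"
    and "convex_on UNIV g"
    and "lower_semicontinuous g"
    and "L \<ge> L\<^sub>f" and "L > 0"
  defines "F \<equiv> \<lambda>z. f z + \<tau> * g z"
    and "T \<equiv> composite_gradient_map f g \<tau>"
    and "r \<equiv> reduced_gradient f g \<tau>"
  shows "F x \<ge> f (T L y) + \<tau> * g (T L y) + r L y \<bullet> (x - y)
           + \<mu> / 2 * (norm (x - y))\<^sup>2 + 1 / (2 * L) * (norm (r L y))\<^sup>2"
proof -
  let ?m = "composite_model f g \<tau> L y"
  define p where "p = T L y"
  have "0 \<le> \<tau>" using assms(1) by simp
  have "F p \<le> ?m p"
  proof -
    have "f p \<le> f y + gradient f y \<bullet> (p - y) + L\<^sub>f / 2 * (norm (p - y))\<^sup>2"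
      using assms(4) by (rule smooth_with_quadratic_upper_bound)
    also have "L\<^sub>f / 2 * (norm (p - y))\<^sup>2 \<le> L / 2 * (norm (p - y))\<^sup>2"
      using assms(8) by (intro mult_right_mono) auto
    finally show ?thesis
      by (simp add: F_def composite_model_def)
  qed
  moreover have "?m p + L / 2 * (norm (x - p))\<^sup>2 \<le> ?m x"
    using strongly_convex_composite_model[OF assms(6) \<open>0 \<le> \<tau>\<close>]
      composite_gradient_map_minimizes[OF assms(6) \<open>0 \<le> \<tau>\<close> assms(9)]
    unfolding p_def T_def by (rule strongly_convex_growth_at_minimizer)
  moreover have "?m x - L / 2 * (norm (x - y))\<^sup>2 + \<mu> / 2 * (norm (x - y))\<^sup>2 \<le> F x"
  proof -
    have "GDERIV f y :> gradient f y"
      using assms(4) by (intro GDERIV_gradient) (simp add: smooth_with_def)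
    from strongly_convex_quadratic_lower_bound[OF assms(5) this, of x]
    show ?thesis by (simp add: F_def composite_model_def)
  qed
  \<comment> \<open>Expand \<open>x - p = (x - y) + (y - p)\<close>, where \<open>y - p\<close> is the reduced gradient divided by \<open>L\<close>.\<close>
  moreover have "L / 2 * (norm (x - p))\<^sup>2 - L / 2 * (norm (x - y))\<^sup>2
      = r L y \<bullet> (x - y) + 1 / (2 * L) * (norm (r L y))\<^sup>2"
  proof -
    have r: "r L y = L *\<^sub>R (y - p)"
      by (simp add: r_def reduced_gradient_def p_def T_def)
    have "(norm (x - p))\<^sup>2 = (norm (x - y))\<^sup>2 + 2 * ((y - p) \<bullet> (x - y)) + (norm (y - p))\<^sup>2"
      unfolding power2_norm_eq_inner by (simp add: inner_diff inner_commute algebra_simps)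
    moreover have "1 / (2 * L) * (norm (r L y))\<^sup>2 = L / 2 * (norm (y - p))\<^sup>2"
      using assms(9) unfolding r norm_scaleR by (simp add: power_mult_distrib power2_eq_square)
    moreover have "r L y \<bullet> (x - y) = L * ((y - p) \<bullet> (x - y))"
      unfolding r by (rule inner_scaleR_left)
    ultimately show ?thesis
      by (simp add: distrib_left add_divide_distrib)
  qed
  ultimately show ?thesis
    unfolding p_def F_def by linarith
qed

end
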